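(* Let $y^3+p_1y^2+q_1y+r_1$ and $z^3+p_2z^2+q_2z+r_2$ (with $p_i,q_i,r_i\in\mathbb{R}$, $r_i\neq 0$ for $i=1,2$) be two Ramanujan cubic polynomials (RCPs), with roots $y_1,y_2,y_3$ and $z_1,z_2,z_3$ respectively. If $$\frac{p_1q_1}{r_1}=\frac{p_2q_2}{r_2},$$ then the numbers $$\frac{y_1}{y_2},\ \frac{y_2}{y_1},\ \frac{y_1}{y_3},\ \frac{y_3}{y_1},\ \frac{y_2}{y_3},\ \frac{y_3}{y_2}$$ are a permutation of the numbers $$\frac{z_1}{z_2},\ \frac{z_2}{z_1},\ \frac{z_1}{z_3},\ \frac{z_3}{z_1},\ \frac{z_2}{z_3},\ \frac{z_3}{z_2}.$$
   Context: For a real number $y$, $y^{1/3}$ denotes the real cube root of $y$, and $y^{2/3}=(y^{1/3})^2$. Definition. Let $p,q,r\in\mathbb{R}$ with $r\neq 0$. The cubic polynomial $x^3+px^2+qx+r$ is called a Ramanujan cubic polynomial (RCP) if all its roots are real and the condition $pr^{1/3}+3r^{2/3}+q=0$ is satisfied. Roots are listed with multiplicity (they are nonzero since $r\ne 0$), and "permutation" means equality of the two lists as multisets. *)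

theory Defs
  imports Complex_Main "HOL-Computational_Algebra.Polynomial"
begin

definition monic_cubic :: "real \<Rightarrow> real \<Rightarrow> real \<Rightarrow> real poly" where
  "monic_cubic p q r = [:r, q, p, 1:]"

(* "All roots are real" refers to the complex roots. For odd n, "root n" is the real n-th root
   on the whole real line, so "root 3 r" is the real cube root for negative r as well. *)
definition ramanujan_cubic :: "real \<Rightarrow> real \<Rightarrow> real \<Rightarrow> bool" where
  "ramanujan_cubic p q r \<longleftrightarrow>
     r \<noteq> 0 \<and>
     (\<forall>w :: complex. poly (map_poly of_real (monic_cubic p q r)) w = 0 \<longrightarrow> w \<in> \<real>) \<and>
     p * root 3 r + 3 * (root 3 r)\<^sup>2 + q = 0"

end

theory Submission
  imports Defs
begin

text \<open>
  Divide the roots of \<open>x\<^sup>3 + p x\<^sup>2 + q x + r\<close> by the real cube root \<open>a\<close> of \<open>r\<close>. The quotients are the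
  roots of \<open>t\<^sup>3 + P t\<^sup>2 + Q t + 1\<close> with \<open>P = p / a\<close> and \<open>Q = q / a\<^sup>2\<close>. In these terms the Ramanujan
  condition reads \<open>P + Q = -3\<close>, and \<open>p q / r = P Q\<close>. Two Ramanujan cubics with the same value
  of \<open>p q / r\<close> therefore have the same sum and the same product of \<open>P\<close> and \<open>Q\<close>, so their pairs
  \<open>(P, Q)\<close> agree up to order. If the pairs are equal, so are the normalised cubics. If they are
  interchanged, each normalised cubic is the reciprocal polynomial of the other, as the constant
  coefficient is \<open>1\<close>, and the normalised roots of one are the inverses of those of the other.
  Both scaling and inversion of the roots preserve the multiset of the quotients of two
  roots at different places in the list, which is the claim.

  The lemma \<open>normalised_roots_of_ramanujan_cubic\<close> carries out the normalisation, \<open>vieta_unique\<close>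
  recovers the roots from the coefficients, and the lemmas about \<open>pair_ratios\<close> express the two
  invariances.
\<close>

text \<open>Over a field that need not be algebraically closed, the roots determine the polynomial up to
  its leading coefficient as soon as there are as many of them as the degree allows: dividing out
  one linear factor lowers both numbers by one.\<close>

lemma smult_prod_proots_if_size_proots_eq_degree:
  fixes p :: "'a :: field poly"
  assumes "size (proots p) = degree p"
  shows "smult (lead_coeff p) (\<Prod>x\<in>#proots p. [:-x, 1:]) = p"
proof (cases "p = 0")
  case False
  with assms show ?thesis
  proof (induction "proots p" arbitrary: p)
    case empty
    then have "degree p = 0" by (metis size_empty)
    then obtain c where "p = [:c:]" by (rule degree_eq_zeroE)
    then show ?case by simp
  next
    case (add a M)
    then have "a \<in># proots p" by (metis union_single_eq_member)
    then have "poly p a = 0" using add.prems by simp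
    then obtain q where q: "p = [:-a, 1:] * q" by (auto simp: poly_eq_0_iff_dvd)
    then have "q \<noteq> 0" using add.prems by auto
    then have roots: "proots p = add_mset a (proots q)"
      unfolding q by (subst proots_mult) auto
    then have M: "M = proots q" using add.hyps(2) by simp
    have deg: "degree p = Suc (degree q)"
      unfolding q using \<open>q \<noteq> 0\<close> by (subst degree_mult_eq) auto
    have "smult (lead_coeff q) (\<Prod>x\<in>#proots q. [:-x, 1:]) = q"
      using add.hyps(1)[OF M] add.prems(1) roots deg \<open>q \<noteq> 0\<close> by simp
    then have "[:-a, 1:] * smult (lead_coeff q) (\<Prod>x\<in>#proots q. [:-x, 1:]) = p"
      by (simp only: q)
    moreover have "lead_coeff p = lead_coeff q"
      unfolding q by (subst lead_coeff_mult) simp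
    ultimately show ?case
      by (simp only: roots image_mset_add_mset prod_mset.add_mset mult_smult_right)
  qed
qed simp

lemma proots_prod_linear_factors:
  "proots (\<Prod>x\<in>#M. [:-x, 1:]) = (M :: 'a :: idom multiset)"
proof (induction M)
  case (add a M)
  have "(\<Prod>x\<in>#M. [:-x, 1:]) \<noteq> 0"
    by auto
  then have "proots ([:-a, 1:] * (\<Prod>x\<in>#M. [:-x, 1:])) = add_mset a M"
    by (subst proots_mult) (simp_all only: add.IH proots_linear_factor, simp_all)
  then show ?case by (simp only: image_mset_add_mset prod_mset.add_mset)
qed simp

lemma prod_three_linear_factors:
  fixes a b c :: "'a :: comm_ring_1"
  shows "(\<Prod>x\<in>#{#a, b, c#}. [:-x, 1:]) =
           [:- (a * b * c), a * b + a * c + b * c, - (a + b + c), 1:]"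
  by (simp add: algebra_simps)

lemma vieta_monic_cubic:
  assumes "proots (monic_cubic p q r) = {#y1, y2, y3#}"
  shows "y1 + y2 + y3 = - p"
    and "y1 * y2 + y1 * y3 + y2 * y3 = q"
    and "y1 * y2 * y3 = - r"
proof -
  have deg: "degree (monic_cubic p q r) = 3" "lead_coeff (monic_cubic p q r) = 1"
    by (simp_all add: monic_cubic_def)
  have "(\<Prod>x\<in>#{#y1, y2, y3#}. [:-x, 1:]) = [:r, q, p, 1:]"
    using smult_prod_proots_if_size_proots_eq_degree[of "monic_cubic p q r"] deg
    unfolding assms by (simp add: monic_cubic_def)
  then show "y1 + y2 + y3 = - p" "y1 * y2 + y1 * y3 + y2 * y3 = q" "y1 * y2 * y3 = - r"
    unfolding prod_three_linear_factors by auto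
qed

text \<open>The hypotheses say that the two monic cubics with these roots have the same coefficients.\<close>

lemma vieta_unique:
  fixes a b c a' b' c' :: "'a :: idom"
  assumes "a + b + c = a' + b' + c'"
    and "a * b + a * c + b * c = a' * b' + a' * c' + b' * c'"
    and "a * b * c = a' * b' * c'"
  shows "{#a, b, c#} = {#a', b', c'#}"
proof -
  have "(\<Prod>x\<in>#{#a, b, c#}. [:-x, 1:]) = (\<Prod>x\<in>#{#a', b', c'#}. [:-x, 1:])"
    unfolding prod_three_linear_factors assms ..
  then show ?thesis
    by (metis proots_prod_linear_factors)
qed

text \<open>A function of the whole multiset, so that the order in which the roots are listed is
  irrelevant. An entry of multiplicity \<open>k\<close> contributes \<open>k (k - 1)\<close> quotients equal to \<open>1\<close>.\<close>

definition pair_ratios :: "'a :: field multiset \<Rightarrow> 'a multiset" where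
  "pair_ratios M = (\<Sum>x\<in>#M. image_mset (\<lambda>y. x / y) (M - {#x#}))"

lemma pair_ratios_triple:
  "pair_ratios {#a, b, c#} = {#a / b, b / a, a / c, c / a, b / c, c / b#}"
proof -
  have "{#a, b, c#} - {#b#} = {#a, c#}" "{#a, b, c#} - {#c#} = {#a, b#}"
    by (metis add_mset_commute add_mset_remove_trivial)+
  then show ?thesis
    by (simp add: pair_ratios_def add_mset_commute)
qed

lemma pair_ratios_triple_divide:
  assumes "k \<noteq> 0"
  shows "pair_ratios {#a / k, b / k, c / k#} = pair_ratios {#a, b, c#}"
  using assms by (simp add: pair_ratios_triple)

text \<open>Inverting the entries exchanges each quotient \<open>x / y\<close> with \<open>y / x\<close>.\<close>

lemma pair_ratios_triple_inverse:
  "pair_ratios {#inverse a, inverse b, inverse c#} = pair_ratios {#a, b, c#}"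
  by (simp add: pair_ratios_triple field_simps add_mset_commute)

text \<open>After division by the cube root of \<open>r\<close>, a single parameter \<open>P\<close> describes the cubic: its
  coefficients are \<open>1, P, -3 - P, 1\<close>, and \<open>p q / r\<close> is a quadratic function of \<open>P\<close> that is
  symmetric under the exchange of \<open>P\<close> and \<open>-3 - P\<close>.\<close>

lemma normalised_roots_of_ramanujan_cubic:
  assumes rc: "ramanujan_cubic p q r"
    and roots: "proots (monic_cubic p q r) = {#y1, y2, y3#}"
  obtains P t1 t2 t3 :: real where
    "t1 + t2 + t3 = - P" "t1 * t2 + t1 * t3 + t2 * t3 = - 3 - P" "t1 * t2 * t3 = - 1"
    "P * (- 3 - P) = p * q / r"
    "pair_ratios {#t1, t2, t3#} = pair_ratios {#y1, y2, y3#}"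
proof -
  define a where "a = root 3 r"
  have "r \<noteq> 0" and cond: "p * a + 3 * a\<^sup>2 + q = 0"
    using rc by (auto simp: ramanujan_cubic_def a_def)
  have a3: "r = a * a * a"
    using odd_real_root_pow[of 3 r] by (simp add: a_def power3_eq_cube)
  have a: "a \<noteq> 0" using a3 \<open>r \<noteq> 0\<close> by auto
  have q: "q = - (p * a) - 3 * (a * a)"
    using cond by (simp add: power2_eq_square)
  note vieta = vieta_monic_cubic[OF roots]
  show thesis
  proof
    show "y1 / a + y2 / a + y3 / a = - (p / a)"
      using vieta(1) by (simp flip: add_divide_distrib)
    have "y1 / a * (y2 / a) + y1 / a * (y3 / a) + y2 / a * (y3 / a) = q / (a * a)"
      using vieta(2) by (simp flip: add_divide_distrib)
    then show "y1 / a * (y2 / a) + y1 / a * (y3 / a) + y2 / a * (y3 / a) = - 3 - p / a"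
      using a unfolding q by (simp add: diff_divide_distrib)
    show "y1 / a * (y2 / a) * (y3 / a) = - 1"
      using vieta(3) a by (simp add: a3)
    show "p / a * (- 3 - p / a) = p * q / r"
      using a unfolding q a3 by (simp add: field_simps)
    show "pair_ratios {#y1 / a, y2 / a, y3 / a#} = pair_ratios {#y1, y2, y3#}"
      by (rule pair_ratios_triple_divide[OF a])
  qed
qed

theorem theorem5:
  fixes p1 q1 r1 p2 q2 r2 y1 y2 y3 z1 z2 z3 :: real
  assumes "ramanujan_cubic p1 q1 r1"
    and "ramanujan_cubic p2 q2 r2"
    and "proots (monic_cubic p1 q1 r1) = {#y1, y2, y3#}"
    and "proots (monic_cubic p2 q2 r2) = {#z1, z2, z3#}"
    and "p1 * q1 / r1 = p2 * q2 / r2"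
  shows "{#y1 / y2, y2 / y1, y1 / y3, y3 / y1, y2 / y3, y3 / y2#} =
         {#z1 / z2, z2 / z1, z1 / z3, z3 / z1, z2 / z3, z3 / z2#}"
proof -
  obtain P t1 t2 t3 where t:
    "t1 + t2 + t3 = - P" "t1 * t2 + t1 * t3 + t2 * t3 = - 3 - P" "t1 * t2 * t3 = - 1"
    "P * (- 3 - P) = p1 * q1 / r1"
    "pair_ratios {#t1, t2, t3#} = pair_ratios {#y1, y2, y3#}"
    using normalised_roots_of_ramanujan_cubic[OF assms(1,3)] .
  obtain R u1 u2 u3 where u:
    "u1 + u2 + u3 = - R" "u1 * u2 + u1 * u3 + u2 * u3 = - 3 - R" "u1 * u2 * u3 = - 1"
    "R * (- 3 - R) = p2 * q2 / r2"
    "pair_ratios {#u1, u2, u3#} = pair_ratios {#z1, z2, z3#}"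
    using normalised_roots_of_ramanujan_cubic[OF assms(2,4)] .
  have "(P - R) * (P + R + 3) = 0"
    using t(4) u(4) assms(5) by (simp add: algebra_simps)
  then consider "P = R" | "P = - 3 - R" by fastforce
  then have "pair_ratios {#t1, t2, t3#} = pair_ratios {#u1, u2, u3#}"
  proof cases
    case 1
    then have "{#t1, t2, t3#} = {#u1, u2, u3#}"
      using t u by (intro vieta_unique) simp_all
    then show ?thesis by simp
  next
    case 2
    have nz: "u1 \<noteq> 0" "u2 \<noteq> 0" "u3 \<noteq> 0" using u(3) by auto
    \<comment> \<open>As the product of the \<open>u\<close>s is \<open>-1\<close>, each inverse is minus the product of the other two.\<close>
    have inv: "inverse u1 = - (u2 * u3)" "inverse u2 = - (u1 * u3)" "inverse u3 = - (u1 * u2)"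
      using u(3) nz by (auto simp: field_simps)
    have "{#t1, t2, t3#} = {#inverse u1, inverse u2, inverse u3#}"
    proof (rule vieta_unique)
      show "t1 + t2 + t3 = inverse u1 + inverse u2 + inverse u3"
        unfolding inv using t(1) u(2) 2 by linarith
      have "inverse u1 * inverse u2 + inverse u1 * inverse u3 + inverse u2 * inverse u3
              = (u1 * u2 * u3) * (u1 + u2 + u3)"
        unfolding inv by algebra
      then show "t1 * t2 + t1 * t3 + t2 * t3 =
          inverse u1 * inverse u2 + inverse u1 * inverse u3 + inverse u2 * inverse u3"
        unfolding u(1,3) using t(2) 2 by simp
      have "inverse u1 * inverse u2 * inverse u3 = inverse (u1 * u2 * u3)" by simp
      then show "t1 * t2 * t3 = inverse u1 * inverse u2 * inverse u3"
        unfolding t(3) u(3) by simp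
    qed
    then show ?thesis
      by (simp only: pair_ratios_triple_inverse)
  qed
  then have "pair_ratios {#y1, y2, y3#} = pair_ratios {#z1, z2, z3#}"
    unfolding t(5) u(5) .
  then show ?thesis
    unfolding pair_ratios_triple .
qed

end
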